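(* For every integer $n>2$ there is a multivariate polynomial $F_n\colon\mathbb{R}^n\to\mathbb{R}$ of degree $n$ such that the active-set method (as defined in the context), applied to maximize $F_n$ over the hypercube $[0,1]^n$ (described by the constraint system $C\mathbf{x}\le\mathbf{c}$ given in the context) and started in $\mathbf{0}$, performs exactly $2^n-1$ iterations before terminating, irrespective of the pivot rule, i.e. for every possible way of resolving the choices the method makes.
   Context: Active-set method. Let $f\colon\mathbb{R}^n\to\mathbb{R}$ be continuously differentiable, $A\in\mathbb{Q}^{m\times n}$, $\mathbf{b}\in\mathbb{Q}^m$, $\mathcal{P}=\{\mathbf{y}: A\mathbf{y}\le\mathbf{b}\}$ bounded, and $\mathbf{x}\in\mathcal{P}$ a starting point. Write $A_{i\cdot}$ for the $i$-th row of $A$, $A_{\mathcal{S}\cdot}$ for the submatrix of rows indexed by $\mathcal{S}$, and $\mathrm{Eq}(\mathbf{x})=\{i: A_{i\cdot}\mathbf{x}=b_i\}$. The method initializes the active set $\mathcal{A}\leftarrow\mathrm{Eq}(\mathbf{x})$ and then repeats the following iteration as long as the set $\mathcal{D}=\{\mathbf{d}: A_{\mathrm{Eq}(\mathbf{x})\cdot}\mathbf{d}\le\mathbf{0},\ \nabla f(\mathbf{x})^\top\mathbf{d}>0\}$ is nonempty (it terminates when $\mathcal{D}=\emptyset$): (1) choose some $\mathbf{d}\in\mathcal{D}$ maximizing $|\{i\in\mathcal{A}: A_{i\cdot}\mathbf{d}=0\}|$; (2) if $A_{\mathcal{A}\cdot}\mathbf{d}\ne\mathbf{0}$, remove from $\mathcal{A}$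 some index $i\in\mathcal{A}$ with $A_{i\cdot}\mathbf{d}<0$; (3) then, if (with the current $\mathcal{A}$) $A_{\mathcal{A}\cdot}\mathbf{d}=\mathbf{0}$: set $\mu\leftarrow\inf\{\mu\ge0: \mathbf{x}+\mu\mathbf{d}\notin\mathcal{P}\text{ or }\nabla f(\mathbf{x}+\mu\mathbf{d})^\top\mathbf{d}\le0\}$, update $\mathbf{x}\leftarrow\mathbf{x}+\mu\mathbf{d}$, and if $\nabla f(\mathbf{x})^\top\mathbf{d}>0$ add to $\mathcal{A}$ some index $j\in\mathrm{Eq}(\mathbf{x})\setminus\mathcal{A}$. Each pass through (1)–(3) is one iteration. A pivot rule is any rule resolving the choices of $\mathbf{d}$, $i$ and $j$. Hypercube representation: $C\in\{-1,0,1\}^{2n\times n}$ has rows $C_{i\cdot}=(\mathbf{e}^i)^\top$ and $C_{(i+n)\cdot}=-(\mathbf{e}^i)^\top$ for $i\in[n]$, and $\mathbf{c}\in\{0,1\}^{2n}$ has $c_i=1$, $c_{i+n}=0$, so $[0,1]^n=\{\mathbf{x}: C\mathbf{x}\le\mathbf{c}\}$; $\mathbf{e}^i$ is the $i$-th unit vector. *)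

theory Defs
  imports "HOL-Analysis.Analysis" "HOL-Library.Poly_Mapping"
begin

section \<open>Multivariate real polynomials\<close>

text \<open>
  A polynomial in the variables \<open>x\<^sub>i\<close> (\<open>i :: 'n\<close>) is a finitely supported map from exponent vectors
  to coefficients.
\<close>

type_synonym 'n real_mpoly = "('n \<Rightarrow>\<^sub>0 nat) \<Rightarrow>\<^sub>0 real"

definition mpoly_eval :: "'n::finite real_mpoly \<Rightarrow> real^'n \<Rightarrow> real" where
  "mpoly_eval p x =
     (\<Sum>e\<in>Poly_Mapping.keys p. Poly_Mapping.lookup p e * (\<Prod>i\<in>UNIV. x $ i ^ Poly_Mapping.lookup e i))"

text \<open>The \<open>insert 0\<close> only fixes the degree of the zero polynomial.\<close>

definition total_degree :: "'n::finite real_mpoly \<Rightarrow> nat" where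
  "total_degree p =
     Max (insert 0 ((\<lambda>e. \<Sum>i\<in>UNIV. Poly_Mapping.lookup e i) ` Poly_Mapping.keys p))"

section \<open>The active-set method\<close>

definition gradient :: "(real^'n \<Rightarrow> real) \<Rightarrow> real^'n \<Rightarrow> real^'n" where
  "gradient f x = (THE g. GDERIV f x :> g)"

definition polyhedron_of :: "real^'n^'m \<Rightarrow> real^'m \<Rightarrow> (real^'n) set" where
  "polyhedron_of A b = {y. \<forall>i. (A *v y) $ i \<le> b $ i}"

definition eq_set :: "real^'n^'m \<Rightarrow> real^'m \<Rightarrow> real^'n \<Rightarrow> 'm set" where
  "eq_set A b x = {i. (A *v x) $ i = b $ i}"

definition improving_dirs ::
    "(real^'n \<Rightarrow> real) \<Rightarrow> real^'n^'m \<Rightarrow> real^'m \<Rightarrow> real^'n \<Rightarrow> (real^'n) set" where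
  "improving_dirs f A b x =
     {d. (\<forall>i\<in>eq_set A b x. (A *v d) $ i \<le> 0) \<and> gradient f x \<bullet> d > 0}"

definition step_length ::
    "(real^'n \<Rightarrow> real) \<Rightarrow> real^'n^'m \<Rightarrow> real^'m \<Rightarrow> real^'n \<Rightarrow> real^'n \<Rightarrow> real" where
  "step_length f A b x d =
     Inf {\<mu>. \<mu> \<ge> 0 \<and>
            (x + \<mu> *\<^sub>R d \<notin> polyhedron_of A b \<or> gradient f (x + \<mu> *\<^sub>R d) \<bullet> d \<le> 0)}"

text \<open>
  The three parts of an iteration are relations, so that every admissible choice of the direction
  \<open>d\<close>, of the index that leaves and of the index that enters the active set is accounted for.
\<close>

definition choose_direction ::
    "(real^'n \<Rightarrow> real) \<Rightarrow> real^'n^'m \<Rightarrow> real^'m \<Rightarrow> real^'n \<Rightarrow> 'm set \<Rightarrow> real^'n \<Rightarrow> bool" where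
  "choose_direction f A b x S d \<longleftrightarrow>
     is_arg_max (\<lambda>d. card {i \<in> S. (A *v d) $ i = 0}) (\<lambda>d. d \<in> improving_dirs f A b x) d"

definition drop_constraint :: "real^'n^'m \<Rightarrow> real^'n \<Rightarrow> 'm set \<Rightarrow> 'm set \<Rightarrow> bool" where
  "drop_constraint A d S S' \<longleftrightarrow>
     (if \<forall>i\<in>S. (A *v d) $ i = 0 then S' = S
      else \<exists>i\<in>S. (A *v d) $ i < 0 \<and> S' = S - {i})"

definition advance ::
    "(real^'n \<Rightarrow> real) \<Rightarrow> real^'n^'m \<Rightarrow> real^'m \<Rightarrow> real^'n \<Rightarrow>
      (real^'n) \<times> 'm set \<Rightarrow> (real^'n) \<times> 'm set \<Rightarrow> bool" where
  "advance f A b d = (\<lambda>(x, S) (x', S').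
     if \<forall>i\<in>S. (A *v d) $ i = 0
     then x' = x + step_length f A b x d *\<^sub>R d \<and>
          (if gradient f x' \<bullet> d > 0
           then \<exists>j \<in> eq_set A b x' - S. S' = insert j S
           else S' = S)
     else x' = x \<and> S' = S)"

inductive iteration ::
    "(real^'n \<Rightarrow> real) \<Rightarrow> real^'n^'m \<Rightarrow> real^'m \<Rightarrow>
      (real^'n) \<times> 'm set \<Rightarrow> (real^'n) \<times> 'm set \<Rightarrow> bool"
  for f A b where
  "choose_direction f A b x S d \<Longrightarrow>
   drop_constraint A d S S' \<Longrightarrow>
   advance f A b d (x, S') t \<Longrightarrow>
   iteration f A b (x, S) t"

definition terminated ::
    "(real^'n \<Rightarrow> real) \<Rightarrow> real^'n^'m \<Rightarrow> real^'m \<Rightarrow> (real^'n) \<times> 'm set \<Rightarrow> bool" where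
  "terminated f A b s \<longleftrightarrow> improving_dirs f A b (fst s) = {}"

text \<open>
  Started in \<open>x\<close>, the method performs exactly \<open>N\<close> iterations before terminating, however the choices
  are resolved: no state that is reachable in fewer than \<open>N\<close> iterations is terminal or stuck, and
  every state that is reached after \<open>N\<close> iterations is terminal.
\<close>

definition performs_exactly ::
    "(real^'n \<Rightarrow> real) \<Rightarrow> real^'n^'m \<Rightarrow> real^'m \<Rightarrow> real^'n \<Rightarrow> nat \<Rightarrow> bool" where
  "performs_exactly f A b x N \<longleftrightarrow>
     (\<forall>k s. (iteration f A b ^^ k) (x, eq_set A b x) s \<longrightarrow>
        (k < N \<longrightarrow> \<not> terminated f A b s \<and> (\<exists>t. iteration f A b s t)) \<and>
        (k = N \<longrightarrow> terminated f A b s))"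

section \<open>The hypercube\<close>

text \<open>
  The rows \<open>i\<close> and \<open>i + n\<close> of the constraint system are indexed by \<open>Inl i\<close> and \<open>Inr i\<close>.
\<close>

definition cube_matrix :: "real^'n^('n::finite + 'n)" where
  "cube_matrix = (\<chi> k. case k of Inl i \<Rightarrow> axis i 1 | Inr i \<Rightarrow> - axis i 1)"

definition cube_rhs :: "real^('n::finite + 'n)" where
  "cube_rhs = (\<chi> k. case k of Inl i \<Rightarrow> 1 | Inr i \<Rightarrow> 0)"

lemma cube_matrix_mult:
  "(cube_matrix *v x) $ Inl i = x $ i"
  "(cube_matrix *v x) $ Inr i = - (x $ i)"
  by (simp_all add: cube_matrix_def matrix_vector_mul_component inner_axis' inner_minus_left)

lemma polyhedron_of_cube: "polyhedron_of cube_matrix cube_rhs = {x. \<forall>i. 0 \<le> x $ i \<and> x $ i \<le> 1}"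
  by (auto simp: polyhedron_of_def split_sum_all cube_matrix_mult cube_rhs_def)

lemma gradient_eqI:
  assumes "GDERIV f x :> g"
  shows "gradient f x = g"
  unfolding gradient_def
proof (rule the_equality[where P = "gderiv f x", OF assms])
  fix h assume "GDERIV f x :> h"
  then have "(\<lambda>y. y \<bullet> h) = (\<lambda>y. y \<bullet> g)"
    using assms has_derivative_unique unfolding gderiv_def by blast
  then show "h = g"
    by (metis inner_commute vector_eq_ldot)
qed

lemma GDERIV_gradient:
  assumes "f differentiable (at x)"
  shows "GDERIV f x :> gradient f x"
proof -
  obtain f' where f': "(f has_derivative f') (at x)"
    using assms unfolding differentiable_def by blast
  then have lin: "linear f'"
    using has_derivative_linear by blast
  have "f' = (\<lambda>h. h \<bullet> adjoint f' 1)"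
    using adjoint_works[OF lin, of _ 1] by (auto simp: fun_eq_iff inner_commute)
  then have "GDERIV f x :> adjoint f' 1"
    using f' unfolding gderiv_def by metis
  then show ?thesis
    using gradient_eqI by metis
qed

lemma differentiable_mpoly_eval: "mpoly_eval p differentiable (at x)"
proof -
  have nth: "(\<lambda>x. x $ i) differentiable (at x)" for i
    by (intro bounded_linear_imp_differentiable bounded_linear_vec_nth)
  have "(\<lambda>x. \<Prod>i\<in>I. x $ i ^ Poly_Mapping.lookup e i) differentiable (at x)"
    if "finite I" for I and e :: "'a \<Rightarrow>\<^sub>0 nat"
    using that by induction (auto intro!: differentiable_mult differentiable_power nth)
  then show ?thesis
    unfolding mpoly_eval_def[abs_def]
    by (intro differentiable_sum differentiable_mult differentiable_const) auto
qed

end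

theory Submission
  imports Defs
begin

text \<open>
  Order the coordinates and put \<open>B\<^sub>i = \<Prod>\<^bsub>j\<ge>i\<^esub> (1 - 2 x\<^sub>j)\<close>. On the vertices of the cube,
  \<open>\<Sum>\<^sub>i 2\<^sup>i (1 - B\<^sub>i) / 2\<close> is the position of \<open>x\<close> in the binary reflected Gray code, so this multilinear
  polynomial of degree \<open>n\<close> increases by 1 along each edge of the Hamiltonian Gray path. It also
  increases along other edges, which would offer shortcuts. An edge in direction \<open>k\<close> belongs to the
  path iff \<open>x\<^bsub>k-1\<^esub> = 1\<close> and \<open>x\<^sub>j = 0\<close> for all \<open>j < k - 1\<close>, i.e. iff the affine function
  \<open>D\<^sub>k = (1 - x\<^bsub>k-1\<^esub>) + \<Sum>\<^bsub>j<k-1\<^esub> x\<^sub>j\<close>, a natural number at each vertex, vanishes. Subtracting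
  \<open>2\<^sup>n x\<^sub>k (1 - x\<^sub>k) D\<^sub>k\<close> for each \<open>k\<close> changes neither the values at the vertices nor the values on
  the path, but makes all shortcuts locally descending. Hence at every vertex but the last the only
  ascending edge is the next edge of the path, and the method has to follow it through all \<open>2\<^sup>n\<close>
  vertices.
\<close>

section \<open>Polynomial functions of bounded degree\<close>

lemma total_degree_le_iff:
  "total_degree p \<le> d \<longleftrightarrow> (\<forall>e\<in>Poly_Mapping.keys p. (\<Sum>i\<in>UNIV. Poly_Mapping.lookup e i) \<le> d)"
  unfolding total_degree_def by (subst Max_le_iff) auto

lemma mpoly_eval_superset:
  assumes "finite E" "Poly_Mapping.keys p \<subseteq> E"
  shows "mpoly_eval p x =
    (\<Sum>e\<in>E. Poly_Mapping.lookup p e * (\<Prod>i\<in>UNIV. x $ i ^ Poly_Mapping.lookup e i))"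
  unfolding mpoly_eval_def using assms
  by (intro sum.mono_neutral_left) (auto simp: in_keys_iff)

lemma mpoly_eval_add: "mpoly_eval (p + q) x = mpoly_eval p x + mpoly_eval q x"
proof -
  let ?E = "Poly_Mapping.keys p \<union> Poly_Mapping.keys q"
  have "Poly_Mapping.keys (p + q) \<subseteq> ?E"
    by (rule keys_add)
  then show ?thesis
    by (simp add: mpoly_eval_superset[of ?E] lookup_add distrib_right sum.distrib)
qed

lemma mpoly_eval_single:
  "mpoly_eval (Poly_Mapping.single e c) x = c * (\<Prod>i\<in>UNIV. x $ i ^ Poly_Mapping.lookup e i)"
  by (subst mpoly_eval_superset[of "{e}"]) auto

text \<open>Degree bounds are tracked on functions, so that the Gray code function can be built up
  from sums and products without writing down a coefficient map for it.\<close>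

definition poly_fun :: "nat \<Rightarrow> (real^'n::finite \<Rightarrow> real) set" where
  "poly_fun d = {mpoly_eval p |p. total_degree p \<le> d}"

lemma poly_fun_mono: "d \<le> d' \<Longrightarrow> f \<in> poly_fun d \<Longrightarrow> f \<in> poly_fun d'"
  unfolding poly_fun_def by auto

lemma poly_fun_monomial:
  assumes "(\<Sum>i\<in>UNIV. Poly_Mapping.lookup e i) \<le> d"
  shows "(\<lambda>x. c * (\<Prod>i\<in>UNIV. x $ i ^ Poly_Mapping.lookup e i)) \<in> poly_fun d"
proof -
  have "(\<lambda>x. c * (\<Prod>i\<in>UNIV. x $ i ^ Poly_Mapping.lookup e i)) = mpoly_eval (Poly_Mapping.single e c)"
    by (simp add: mpoly_eval_single fun_eq_iff)
  moreover have "total_degree (Poly_Mapping.single e c) \<le> d"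
    using assms by (auto simp: total_degree_le_iff split: if_splits)
  ultimately show ?thesis unfolding poly_fun_def by blast
qed

lemma poly_fun_const: "(\<lambda>x. c) \<in> poly_fun d"
  using poly_fun_monomial[of 0 d c] by simp

lemma poly_fun_add:
  assumes "f \<in> poly_fun d" "g \<in> poly_fun d"
  shows "(\<lambda>x. f x + g x) \<in> poly_fun d"
proof -
  obtain p q where pq: "f = mpoly_eval p" "total_degree p \<le> d" "g = mpoly_eval q" "total_degree q \<le> d"
    using assms unfolding poly_fun_def by blast
  have "total_degree (p + q) \<le> d"
    using pq(2,4) keys_add[of p q] unfolding total_degree_le_iff by blast
  moreover have "(\<lambda>x. f x + g x) = mpoly_eval (p + q)"
    by (simp add: pq mpoly_eval_add fun_eq_iff)
  ultimately show ?thesis unfolding poly_fun_def by blast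
qed

lemma poly_fun_sum:
  assumes "\<And>i. i \<in> I \<Longrightarrow> f i \<in> poly_fun d"
  shows "(\<lambda>x. \<Sum>i\<in>I. f i x) \<in> poly_fun d"
  using assms by (induction I rule: infinite_finite_induct) (auto intro: poly_fun_const poly_fun_add)

text \<open>Multiplication by the variable k shifts every exponent vector by a unit vector.
  Attaching one such factor at a time is enough to form all products below.\<close>

lemma poly_fun_times_affine:
  assumes "f \<in> poly_fun d"
  shows "(\<lambda>x. f x * (a + b * x $ k)) \<in> poly_fun (Suc d)"
proof -
  obtain p where p: "f = mpoly_eval p" "total_degree p \<le> d"
    using assms unfolding poly_fun_def by blast
  let ?l = Poly_Mapping.lookup
  have "(\<lambda>x. \<Sum>e\<in>Poly_Mapping.keys p. a * ?l p e * (\<Prod>i\<in>UNIV. x $ i ^ ?l e i)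
      + b * ?l p e * (\<Prod>i\<in>UNIV. x $ i ^ ?l (e + Poly_Mapping.single k 1) i)) \<in> poly_fun (Suc d)"
  proof (intro poly_fun_sum poly_fun_add poly_fun_monomial)
    fix e assume "e \<in> Poly_Mapping.keys p"
    then have e: "(\<Sum>i\<in>UNIV. ?l e i) \<le> d" using p(2) by (auto simp: total_degree_le_iff)
    then show "(\<Sum>i\<in>UNIV. ?l e i) \<le> Suc d" by simp
    show "(\<Sum>i\<in>UNIV. ?l (e + Poly_Mapping.single k 1) i) \<le> Suc d"
      using e by (simp add: lookup_add lookup_single when_def sum.distrib)
  qed
  moreover have "(\<Prod>i\<in>UNIV. x $ i ^ ?l (e + Poly_Mapping.single k 1) i) =
      (\<Prod>i\<in>UNIV. x $ i ^ ?l e i) * x $ k" for e and x :: "real^'a"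
  proof -
    have "(\<Prod>i\<in>UNIV. x $ i ^ ?l (e + Poly_Mapping.single k 1) i) =
      (\<Prod>i\<in>UNIV. x $ i ^ ?l e i) * (\<Prod>i\<in>UNIV. x $ i ^ (if k = i then 1 else 0))"
      by (simp only: lookup_add lookup_single when_def power_add prod.distrib)
    also have "(\<Prod>i\<in>UNIV. x $ i ^ (if k = i then 1 else 0)) = (\<Prod>i\<in>UNIV. if k = i then x $ i else 1)"
      by (intro prod.cong) auto
    finally show ?thesis by simp
  qed
  ultimately show ?thesis
    by (simp add: p(1) mpoly_eval_def[abs_def] sum_distrib_right sum_distrib_left algebra_simps sum.distrib)
qed

section \<open>Vertex sums that detect the full degree\<close>

definition cube_vertex :: "'n::finite set \<Rightarrow> real^'n" where
  "cube_vertex T = (\<chi> i. of_bool (i \<in> T))"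

text \<open>Expanding the product on the right picks \<open>a i\<close> on a subset T and
  \<open>b i\<close> off it.\<close>

lemma sum_Pow_prod_if:
  fixes a b :: "'a \<Rightarrow> 'b::comm_ring_1"
  assumes "finite I"
  shows "(\<Sum>T\<in>Pow I. \<Prod>i\<in>I. if i \<in> T then a i else b i) = (\<Prod>i\<in>I. a i + b i)"
  using assms
  by (auto simp: prod_add prod.If_cases Int_absorb1 Diff_eq intro!: sum.cong arg_cong2[where f = "(*)"] prod.cong)

text \<open>Up to sign this is the mixed difference in all n coordinate directions. It kills every
  monomial in which some variable is missing, and below degree n each monomial is of this
  kind.\<close>

lemma alternating_sum_mpoly_eval:
  fixes p :: "'n::finite real_mpoly"
  assumes "total_degree p < CARD('n)"
  shows "(\<Sum>T\<in>UNIV. (\<Prod>i\<in>UNIV. if i \<in> T then - 1 else 1) * mpoly_eval p (cube_vertex T)) = 0"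
proof -
  let ?l = Poly_Mapping.lookup
  have z: "(\<Sum>T\<in>UNIV. (\<Prod>i\<in>UNIV. if i \<in> T then - 1 else 1) * (\<Prod>i\<in>UNIV. cube_vertex T $ i ^ ?l e i)) = 0"
    if "e \<in> Poly_Mapping.keys p" for e
  proof -
    have "\<exists>i. ?l e i = 0"
    proof (rule ccontr)
      assume "\<not> ?thesis"
      then have "(\<Sum>i\<in>(UNIV :: 'n set). 1) \<le> (\<Sum>i\<in>UNIV. ?l e i)"
        by (intro sum_mono) (simp add: Suc_le_eq)
      then show False
        using assms that total_degree_le_iff[of p "total_degree p"] by fastforce
    qed
    then obtain k where k: "?l e k = 0" by blast
    \<comment> \<open>The sum factors over the coordinates: membership in T contributes -1, absence
      contributes \<open>0 ^ ?l e i\<close>. At k the factor is -1 + 0^0 = 0.\<close>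
    have "(\<Sum>T\<in>UNIV. (\<Prod>i\<in>UNIV. if i \<in> T then - 1 else 1) * (\<Prod>i\<in>UNIV. cube_vertex T $ i ^ ?l e i))
      = (\<Sum>T\<in>Pow UNIV. \<Prod>i\<in>UNIV. if i \<in> T then - 1 else 0 ^ ?l e i)"
      unfolding prod.distrib[symmetric] Pow_UNIV
      by (intro sum.cong prod.cong) (auto simp: cube_vertex_def)
    also have "\<dots> = (\<Prod>i\<in>UNIV. - 1 + 0 ^ ?l e i)"
      by (rule sum_Pow_prod_if) simp
    also have "\<dots> = 0"
      using k by (intro prod_zero bexI[of _ k]) auto
    finally show ?thesis .
  qed
  have "(\<Sum>T\<in>UNIV. (\<Prod>i\<in>UNIV. if i \<in> T then - 1 else 1) * mpoly_eval p (cube_vertex T)) =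
    (\<Sum>e\<in>Poly_Mapping.keys p. ?l p e * (\<Sum>T\<in>UNIV. (\<Prod>i\<in>UNIV. if i \<in> T then - 1 else 1) *
       (\<Prod>i\<in>UNIV. cube_vertex T $ i ^ ?l e i)))"
    unfolding mpoly_eval_def sum_distrib_left
    by (subst sum.swap) (simp add: algebra_simps)
  also have "\<dots> = 0" using z by simp
  finally show ?thesis .
qed

section \<open>The active-set method on the vertices of the cube\<close>

definition cube_vertices :: "(real^'n) set" where
  "cube_vertices = {x. \<forall>i. x $ i = 0 \<or> x $ i = 1}"

lemma cube_verticesD: "x \<in> cube_vertices \<Longrightarrow> x $ i = 0 \<or> x $ i = 1"
  by (simp add: cube_vertices_def)

text \<open>At a vertex \<open>1 - 2 * x $ k\<close> is 1 or -1, so this is the edge direction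
  towards the neighbour that differs from x in coordinate k.\<close>

definition inward :: "real^'n \<Rightarrow> 'n \<Rightarrow> real^'n::finite" where
  "inward x k = axis k (1 - 2 * x $ k)"

text \<open>Of the two bounds on coordinate k, this is the one that holds with equality at the
  vertex x.\<close>

definition tight :: "real^'n \<Rightarrow> 'n::finite \<Rightarrow> 'n + 'n" where
  "tight x k = (if x $ k = 1 then Inl k else Inr k)"

lemma inj_tight: "inj (tight x)"
  by (auto simp: tight_def inj_on_def split: if_splits)

lemma eq_set_cube_vertex:
  assumes "x \<in> cube_vertices"
  shows "eq_set cube_matrix cube_rhs x = range (tight x)"
proof -
  have "i \<in> eq_set cube_matrix cube_rhs x \<longleftrightarrow> i \<in> range (tight x)" for i
    using assms
    by (cases i) (auto simp: eq_set_def cube_matrix_mult cube_rhs_def tight_def cube_vertices_def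
        image_iff split: if_splits)
  then show ?thesis by blast
qed

lemma cube_matrix_mult_tight:
  assumes "x \<in> cube_vertices"
  shows "(cube_matrix *v d) $ tight x i = - (1 - 2 * x $ i) * d $ i"
  using cube_verticesD[OF assms, of i] by (auto simp: tight_def cube_matrix_mult)

lemma inward_vertex:
  assumes "x \<in> cube_vertices"
  shows "x + inward x k \<in> cube_vertices"
  using assms by (auto simp: cube_vertices_def inward_def axis_def)

text \<open>Along an edge the tight bound on coordinate k is exchanged for the opposite one; one
  iteration has to change the active set in just this way.\<close>

lemma tight_inward:
  assumes "x \<in> cube_vertices"
  shows "range (tight (x + inward x k)) = insert (tight (x + inward x k) k) (range (tight x) - {tight x k})"
    "tight (x + inward x k) k \<notin> range (tight x)"
proof -
  have "tight (x + inward x k) i = tight x i" if "i \<noteq> k" for i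
    using that by (auto simp: tight_def inward_def axis_def)
  moreover have "tight x i = tight x k \<longleftrightarrow> i = k" for i
    using inj_tight[of x] by (auto simp: inj_on_def)
  ultimately show "range (tight (x + inward x k)) = insert (tight (x + inward x k) k) (range (tight x) - {tight x k})"
    by (auto simp: image_iff) metis+
  show "tight (x + inward x k) k \<notin> range (tight x)"
    using cube_verticesD[OF assms, of k]
    by (auto simp: tight_def inward_def split: if_splits)
qed

lemma card_tight_zero:
  assumes "x \<in> cube_vertices"
  shows "card {i \<in> range (tight x). (cube_matrix *v d) $ i = 0} = card {i. d $ i = 0}"
proof -
  have "1 - 2 * x $ i \<noteq> 0" for i
    using cube_verticesD[OF assms, of i] by auto
  then have "{i \<in> range (tight x). (cube_matrix *v d) $ i = 0} = tight x ` {i. d $ i = 0}"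
    by (auto simp: cube_matrix_mult_tight[OF assms])
  then show ?thesis
    using inj_tight by (metis card_image inj_on_subset subset_UNIV)
qed

lemma improving_dirs_cube_vertex:
  assumes "x \<in> cube_vertices"
  shows "d \<in> improving_dirs f cube_matrix cube_rhs x \<longleftrightarrow>
    (\<forall>i. 0 \<le> (1 - 2 * x $ i) * d $ i) \<and> 0 < gradient f x \<bullet> d"
  by (simp add: improving_dirs_def eq_set_cube_vertex assms cube_matrix_mult_tight)
    (simp add: algebra_simps)

text \<open>Every d is the combination of the edge directions with coefficients
  \<open>(1 - 2 * x $ i) * d $ i\<close>, which are all nonnegative iff d points into the cube.
  Hence an improving direction at a vertex forces an ascending edge.\<close>

lemma inner_eq_sum_inward:
  assumes "x \<in> cube_vertices"
  shows "g \<bullet> d = (\<Sum>i\<in>UNIV. (g \<bullet> inward x i) * ((1 - 2 * x $ i) * d $ i))"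
proof -
  have "g $ i * d $ i = (g \<bullet> inward x i) * ((1 - 2 * x $ i) * d $ i)" for i
    using cube_verticesD[OF assms, of i] by (auto simp: inward_def inner_axis)
  then show ?thesis unfolding inner_vec_def[of g d] by (intro sum.cong refl) simp
qed

lemma improving_dirs_cube_vertex_empty:
  assumes "x \<in> cube_vertices" "\<And>k. gradient f x \<bullet> inward x k \<le> 0"
  shows "improving_dirs f cube_matrix cube_rhs x = {}"
proof -
  have "gradient f x \<bullet> d \<le> 0" if "\<forall>i. 0 \<le> (1 - 2 * x $ i) * d $ i" for d
    unfolding inner_eq_sum_inward[OF assms(1), of _ d]
    using that assms(2) by (intro sum_nonpos mult_nonpos_nonneg) auto
  then show ?thesis
    using improving_dirs_cube_vertex[OF assms(1)] by (meson equals0I not_less)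
qed

lemma inward_nth: "inward x k $ i = (if i = k then 1 - 2 * x $ k else 0)"
  by (simp add: inward_def axis_def)

lemma inward_improving:
  assumes "x \<in> cube_vertices" "0 < gradient f x \<bullet> inward x k"
  shows "inward x k \<in> improving_dirs f cube_matrix cube_rhs x"
  using assms by (auto simp: improving_dirs_cube_vertex inward_nth)

text \<open>An improving direction is nonzero, so it has at most n - 1 zero coordinates, and an
  ascending edge attains this bound. The maximizers are therefore ascending edge directions, up to a
  positive scaling c left to the pivot rule.\<close>

lemma choose_direction_cube_vertex:
  fixes x :: "real^'n::finite"
  assumes x: "x \<in> cube_vertices" and ex: "0 < gradient f x \<bullet> inward x k0"
  shows "choose_direction f cube_matrix cube_rhs x (range (tight x)) d \<longleftrightarrow>
    (\<exists>k c. 0 < c \<and> d = c *\<^sub>R inward x k \<and> 0 < gradient f x \<bullet> inward x k)"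
proof -
  let ?D = "improving_dirs f cube_matrix cube_rhs x"
  have nz: "1 - 2 * x $ i \<noteq> 0" for i
    using cube_verticesD[OF x, of i] by auto
  have ub: "card {i. d $ i = 0} < CARD('n)" if "d \<in> ?D" for d :: "real^'n"
  proof (rule psubset_card_mono)
    have "d \<noteq> 0" using that by (auto simp: improving_dirs_def)
    then show "{i. d $ i = 0} \<subset> UNIV" by (auto simp: vec_eq_iff)
  qed simp
  have edge: "card {i. (c *\<^sub>R inward x k) $ i = 0} = CARD('n) - 1" if "0 < c" for c k
  proof -
    have "{i. (c *\<^sub>R inward x k) $ i = 0} = UNIV - {k}"
      using that nz by (auto simp: inward_nth)
    then show ?thesis by (simp add: card_Diff_singleton)
  qed
  have scaled: "c *\<^sub>R inward x k \<in> ?D" if "0 < c" "0 < gradient f x \<bullet> inward x k" for c k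
    using that by (auto simp: improving_dirs_cube_vertex[OF x] inward_nth mult.left_commute[of _ c])
  show ?thesis
    unfolding choose_direction_def is_arg_max_def card_tight_zero[OF x]
  proof safe
    fix k c assume c: "(0::real) < c" "0 < gradient f x \<bullet> inward x k"
    show "c *\<^sub>R inward x k \<in> ?D" using scaled c .
  next
    fix k c y assume c: "(0::real) < c" "0 < gradient f x \<bullet> inward x k" and y: "y \<in> ?D"
      "card {i. (c *\<^sub>R inward x k) $ i = 0} < card {i. y $ i = 0}"
    then show False using ub[OF y(1)] edge[OF c(1), of k] by simp
  next
    assume d: "d \<in> ?D" and "\<nexists>y. y \<in> ?D \<and> card {i. d $ i = 0} < card {i. y $ i = 0}"
    then have "card {i. inward x k0 $ i = 0} \<le> card {i. d $ i = 0}"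
      using inward_improving[OF x ex] by (meson not_less)
    then have "card {i. d $ i = 0} = CARD('n) - 1"
      using ub[OF d] edge[of 1 k0] by simp
    then have "card (UNIV - {i. d $ i = 0}) = 1"
      using ub[OF d] by (subst card_Diff_subset) auto
    then obtain k where "UNIV - {i. d $ i = 0} = {k}"
      by (auto simp: card_1_singleton_iff)
    then have k: "\<And>i. d $ i \<noteq> 0 \<longleftrightarrow> i = k" by auto
    \<comment> \<open>The coefficient of d along the edge: \<open>1 - 2 * x $ k\<close> is its own
      inverse.\<close>
    define c where "c = (1 - 2 * x $ k) * d $ k"
    have sq: "(1 - 2 * x $ k) * (1 - 2 * x $ k) = 1"
      using cube_verticesD[OF x, of k] by auto
    have dc: "d = c *\<^sub>R inward x k"
      using k sq by (auto simp: vec_eq_iff inward_nth c_def algebra_simps)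
    have "c \<ge> 0" "0 < gradient f x \<bullet> d"
      using d by (auto simp: improving_dirs_cube_vertex[OF x] c_def)
    then show "\<exists>k c. 0 < c \<and> d = c *\<^sub>R inward x k \<and> 0 < gradient f x \<bullet> inward x k"
      using dc by (auto simp: zero_less_mult_iff intro!: exI[of _ k] exI[of _ c])
  qed
qed

section \<open>Iterations as moves to neighbouring vertices\<close>

lemma step_length_edge:
  assumes x: "x \<in> cube_vertices" and c: "0 < c"
    and pos: "\<And>t. 0 \<le> t \<Longrightarrow> t \<le> 1 \<Longrightarrow> 0 < gradient f (x + t *\<^sub>R inward x k) \<bullet> inward x k"
  shows "step_length f cube_matrix cube_rhs x (c *\<^sub>R inward x k) = 1 / c"
proof -
  have P: "x + t *\<^sub>R inward x k \<in> polyhedron_of cube_matrix cube_rhs \<longleftrightarrow> t \<le> 1" if "0 \<le> t" for t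
  proof -
    have "0 \<le> x $ i \<and> x $ i \<le> 1" for i
      using cube_verticesD[OF x, of i] by auto
    then show ?thesis
      using that cube_verticesD[OF x, of k]
      by (auto simp: polyhedron_of_cube inward_nth)
  qed
  \<comment> \<open>The half-line is open: at \<open>1 / c\<close> the far vertex is still feasible
    and the slope there is still positive. The infimum \<open>1 / c\<close> is thus not attained,
    and it cancels the scaling of the direction.\<close>
  have "{\<mu>. 0 \<le> \<mu> \<and> (x + \<mu> *\<^sub>R c *\<^sub>R inward x k \<notin> polyhedron_of cube_matrix cube_rhs \<or>
      gradient f (x + \<mu> *\<^sub>R c *\<^sub>R inward x k) \<bullet> (c *\<^sub>R inward x k) \<le> 0)} = {1 / c<..}" (is "?L = _")
  proof -
    have "\<mu> \<in> ?L \<longleftrightarrow> 0 \<le> \<mu> \<and> 1 < \<mu> * c" for \<mu>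
      using P[of "\<mu> * c"] pos[of "\<mu> * c"] c
      by (auto simp: mult_le_0_iff not_le)
    moreover have "0 \<le> \<mu> \<and> 1 < \<mu> * c \<longleftrightarrow> 1 / c < \<mu>" for \<mu>
    proof
      assume "1 / c < \<mu>"
      moreover have "0 < 1 / c" using c by simp
      ultimately have "0 \<le> \<mu>" by linarith
      then show "0 \<le> \<mu> \<and> 1 < \<mu> * c"
        using c \<open>1 / c < \<mu>\<close> by (simp add: pos_divide_less_eq)
    qed (use c in \<open>simp add: pos_divide_less_eq\<close>)
    ultimately show ?thesis by blast
  qed
  then show ?thesis unfolding step_length_def by simp
qed

text \<open>States at a vertex with all tight constraints active are mapped to states of the same
  kind. Beyond the edge and its scaling the pivot rule has no freedom, and the scaling does not
  affect the result.\<close>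

lemma iteration_cube_vertex:
  assumes x: "x \<in> cube_vertices" and ex: "\<exists>k. 0 < gradient f x \<bullet> inward x k"
    and pos: "\<And>k t. 0 < gradient f x \<bullet> inward x k \<Longrightarrow> 0 \<le> t \<Longrightarrow> t \<le> 1 \<Longrightarrow>
      0 < gradient f (x + t *\<^sub>R inward x k) \<bullet> inward x k"
  shows "iteration f cube_matrix cube_rhs (x, eq_set cube_matrix cube_rhs x) s \<longleftrightarrow>
    (\<exists>k. 0 < gradient f x \<bullet> inward x k \<and>
      s = (x + inward x k, eq_set cube_matrix cube_rhs (x + inward x k)))"
proof -
  have nz: "1 - 2 * x $ i \<noteq> 0" "(1 - 2 * x $ i) * (1 - 2 * x $ i) = 1" for i
    using cube_verticesD[OF x, of i] by auto
  have tz: "(cube_matrix *v (c *\<^sub>R inward x k)) $ tight x i = (if i = k then - c else 0)" for c k i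
    using nz(2)[of k] by (simp add: cube_matrix_mult_tight[OF x] inward_nth algebra_simps)
  have inj: "tight x i = tight x k \<longleftrightarrow> i = k" for i k
    using inj_tight[of x] by (auto simp: inj_on_def)
  \<comment> \<open>The constraint at coordinate k is the only active one with nonzero product, so
    the leaving index is forced.\<close>
  have drop: "drop_constraint cube_matrix (c *\<^sub>R inward x k) (range (tight x)) S' \<longleftrightarrow>
      S' = range (tight x) - {tight x k}" if "0 < c" for c k S'
    using that by (auto simp: drop_constraint_def tz)
  have adv: "advance f cube_matrix cube_rhs (c *\<^sub>R inward x k) (x, range (tight x) - {tight x k}) s \<longleftrightarrow>
      s = (x + inward x k, range (tight (x + inward x k)))"
    if c: "0 < c" and k: "0 < gradient f x \<bullet> inward x k" for c k
  proof -
    have "\<forall>i\<in>range (tight x) - {tight x k}. (cube_matrix *v (c *\<^sub>R inward x k)) $ i = 0"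
      by (auto simp: tz inj split: if_splits)
    moreover have "x + step_length f cube_matrix cube_rhs x (c *\<^sub>R inward x k) *\<^sub>R c *\<^sub>R inward x k = x + inward x k"
      using c by (simp add: step_length_edge[OF x c pos[OF k]])
    \<comment> \<open>Positive slope at the far vertex selects the branch of \<open>advance\<close>
      that adds a constraint; the next fact leaves a single candidate for it.\<close>
    moreover have "0 < gradient f (x + inward x k) \<bullet> (c *\<^sub>R inward x k)"
      using c pos[OF k, of 1] by simp
    moreover have "eq_set cube_matrix cube_rhs (x + inward x k) - (range (tight x) - {tight x k}) =
        {tight (x + inward x k) k}"
      using tight_inward[OF x, of k] by (auto simp: eq_set_cube_vertex inward_vertex x)
    ultimately show ?thesis
      unfolding advance_def tight_inward(1)[OF x, of k]
      by (cases s) (simp del: inner_scaleR_right scaleR_scaleR add_left_cancel cong: conj_cong)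
  qed
  from ex obtain k0 where k0: "0 < gradient f x \<bullet> inward x k0" by blast
  note ch = choose_direction_cube_vertex[OF x k0]
  have E: "eq_set cube_matrix cube_rhs x = range (tight x)"
    "\<And>k. eq_set cube_matrix cube_rhs (x + inward x k) = range (tight (x + inward x k))"
    by (simp_all add: eq_set_cube_vertex inward_vertex x)
  show ?thesis
    unfolding E
  proof
    assume "iteration f cube_matrix cube_rhs (x, range (tight x)) s"
    then obtain d S' where 1: "choose_direction f cube_matrix cube_rhs x (range (tight x)) d"
      "drop_constraint cube_matrix d (range (tight x)) S'"
      "advance f cube_matrix cube_rhs d (x, S') s"
      by (auto elim: iteration.cases)
    then obtain k c where "0 < c" "d = c *\<^sub>R inward x k" "0 < gradient f x \<bullet> inward x k"
      using ch by blast
    then show "\<exists>k. 0 < gradient f x \<bullet> inward x k \<and> s = (x + inward x k, range (tight (x + inward x k)))"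
      using 1 drop adv by auto
  next
    assume "\<exists>k. 0 < gradient f x \<bullet> inward x k \<and> s = (x + inward x k, range (tight (x + inward x k)))"
    then obtain k where k: "0 < gradient f x \<bullet> inward x k"
      "s = (x + inward x k, range (tight (x + inward x k)))" by blast
    show "iteration f cube_matrix cube_rhs (x, range (tight x)) s"
    proof (rule iteration.intros)
      show "choose_direction f cube_matrix cube_rhs x (range (tight x)) (1 *\<^sub>R inward x k)"
        using ch k(1) zero_less_one by blast
      show "drop_constraint cube_matrix (1 *\<^sub>R inward x k) (range (tight x)) (range (tight x) - {tight x k})"
        using drop zero_less_one by blast
      show "advance f cube_matrix cube_rhs (1 *\<^sub>R inward x k) (x, range (tight x) - {tight x k}) s"
        using adv[OF zero_less_one k(1)] k(2) by blast
    qed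
  qed
qed

text \<open>The objective serves as iteration counter: it starts at 0 and grows by 1 per iteration,
  and an ascending edge is missing exactly when its value is N.\<close>

lemma performs_exactly_cube:
  assumes x0: "x0 \<in> cube_vertices" "f x0 = 0"
    and pos: "\<And>x k t. x \<in> cube_vertices \<Longrightarrow> 0 < gradient f x \<bullet> inward x k \<Longrightarrow> 0 \<le> t \<Longrightarrow> t \<le> 1 \<Longrightarrow>
      0 < gradient f (x + t *\<^sub>R inward x k) \<bullet> inward x k"
    and step: "\<And>x k. x \<in> cube_vertices \<Longrightarrow> 0 < gradient f x \<bullet> inward x k \<Longrightarrow>
      f (x + inward x k) = f x + 1"
    and stop: "\<And>x. x \<in> cube_vertices \<Longrightarrow> (\<exists>k. 0 < gradient f x \<bullet> inward x k) \<longleftrightarrow> f x \<noteq> real N"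
  shows "performs_exactly f cube_matrix cube_rhs x0 N"
proof -
  let ?E = "eq_set cube_matrix cube_rhs"
  have reach: "\<exists>x\<in>cube_vertices. s = (x, ?E x) \<and> f x = real m"
    if "(iteration f cube_matrix cube_rhs ^^ m) (x0, ?E x0) s" "m \<le> N" for m s
    using that
  proof (induction m arbitrary: s)
    case 0
    then show ?case using x0 by auto
  next
    case (Suc m)
    then obtain u where u: "(iteration f cube_matrix cube_rhs ^^ m) (x0, ?E x0) u"
      "iteration f cube_matrix cube_rhs u s"
      by auto
    then obtain x where x: "x \<in> cube_vertices" "u = (x, ?E x)" "f x = real m"
      using Suc.IH[OF u(1)] Suc.prems(2) by auto
    then have "\<exists>k. 0 < gradient f x \<bullet> inward x k"
      using stop Suc.prems by simp
    then obtain k where "0 < gradient f x \<bullet> inward x k" "s = (x + inward x k, ?E (x + inward x k))"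
      using iteration_cube_vertex[OF x(1) _ pos[OF x(1)]] u(2) x(2) by blast
    then show ?case
      using x step inward_vertex by force
  qed
  show ?thesis
    unfolding performs_exactly_def terminated_def
  proof (intro allI impI conjI)
    fix m s assume m: "(iteration f cube_matrix cube_rhs ^^ m) (x0, ?E x0) s"
    {
      assume "m < N"
      then obtain x where x: "x \<in> cube_vertices" "s = (x, ?E x)" "f x \<noteq> real N"
        using reach[OF m] by force
      then obtain k where k: "0 < gradient f x \<bullet> inward x k" using stop by blast
      show "improving_dirs f cube_matrix cube_rhs (fst s) \<noteq> {}"
        using inward_improving[OF x(1) k] x(2) by auto
      show "\<exists>t. iteration f cube_matrix cube_rhs s t"
        using iteration_cube_vertex[OF x(1) _ pos[OF x(1)]] k x(2) by blast
    }
    assume "m = N"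
    then obtain x where "x \<in> cube_vertices" "s = (x, ?E x)" "f x = real N"
      using reach[OF m] by force
    then show "improving_dirs f cube_matrix cube_rhs (fst s) = {}"
      using stop by (metis fst_conv improving_dirs_cube_vertex_empty not_less)
  qed
qed

section \<open>The Gray code polynomial\<close>

text \<open>This is \<open>B\<^sub>i\<close>, with \<open>h\<close> enumerating the coordinates
  because the index type carries no order. At a vertex (1 - \<open>B\<^sub>i\<close>) / 2 is bit i
  of the position in the Gray code.\<close>

definition parity_sign :: "(nat \<Rightarrow> 'n) \<Rightarrow> real^'n::finite \<Rightarrow> nat \<Rightarrow> real" where
  "parity_sign h x i = (\<Prod>j = i..<CARD('n). 1 - 2 * x $ h j)"

text \<open>This is \<open>D\<^sub>k\<close>. At k = 0 the sum is empty: flipping the first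
  coordinate is a path edge at every vertex.\<close>

definition gray_defect :: "(nat \<Rightarrow> 'n) \<Rightarrow> real^'n::finite \<Rightarrow> nat \<Rightarrow> real" where
  "gray_defect h x k = (\<Sum>j<k. if Suc j = k then 1 - x $ h j else x $ h j)"

definition gray_fun :: "(nat \<Rightarrow> 'n) \<Rightarrow> real^'n::finite \<Rightarrow> real" where
  "gray_fun h x = (\<Sum>i<CARD('n). 2 ^ i * (1 - parity_sign h x i) / 2) -
     2 ^ CARD('n) * (\<Sum>k<CARD('n). x $ h k * (1 - x $ h k) * gray_defect h x k)"

section \<open>Exact degree of the Gray code polynomial\<close>

lemma poly_fun_prod_affine:
  assumes "finite J"
  shows "(\<lambda>x. c * (\<Prod>j\<in>J. a j + b j * x $ h j)) \<in> poly_fun (card J)"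
  using assms
proof (induction J)
  case empty
  then show ?case by (simp add: poly_fun_const)
next
  case (insert j J)
  then show ?case
    using poly_fun_times_affine[OF insert.IH, of "a j" "b j" "h j"] by (simp add: algebra_simps)
qed

lemma poly_fun_gray_defect: "(\<lambda>x. gray_defect h x k) \<in> poly_fun 1"
proof -
  have lin: "(\<lambda>x. a + b * x $ l) \<in> poly_fun 1" for a b and l :: 'a
    using poly_fun_times_affine[OF poly_fun_const[of 1 0], of a b l] by simp
  have "gray_defect h x k =
      (\<Sum>j<k. of_bool (Suc j = k) + (if Suc j = k then - 1 else 1) * x $ h j)" for x
    unfolding gray_defect_def by (intro sum.cong) auto
  then show ?thesis
    by (simp only:) (intro poly_fun_sum lin)
qed

text \<open>The penalty terms are cubic; this is the only place where \<open>n > 2\<close> matters.\<close>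

lemma poly_fun_gray_fun:
  assumes "CARD('n::finite) > 2"
  shows "gray_fun (h :: nat \<Rightarrow> 'n) \<in> poly_fun CARD('n)"
proof -
  let ?n = "CARD('n)"
  have par: "(\<lambda>x. - (2 ^ i) / 2 * (\<Prod>j = i..<?n. 1 + (- 2) * x $ h j)) \<in> poly_fun ?n" for i
    by (rule poly_fun_mono[OF _ poly_fun_prod_affine]) auto
  have pen: "(\<lambda>x. gray_defect h x k * (0 + - (2 ^ ?n) * x $ h k) * (1 + (- 1) * x $ h k)) \<in> poly_fun ?n" for k
    using assms
    by (intro poly_fun_mono[OF _ poly_fun_times_affine[OF poly_fun_times_affine[OF poly_fun_gray_defect]]]) simp
  have "gray_fun h x =
     (\<Sum>i<?n. 2 ^ i / 2 + (- (2 ^ i) / 2 * (\<Prod>j = i..<?n. 1 + (- 2) * x $ h j))) +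
     (\<Sum>k<?n. gray_defect h x k * (0 + - (2 ^ ?n) * x $ h k) * (1 + (- 1) * x $ h k))" for x
    unfolding gray_fun_def parity_sign_def
    by (simp add: sum_distrib_left sum_subtractf sum_negf diff_divide_distrib algebra_simps)
  then have "gray_fun h = (\<lambda>x.
     (\<Sum>i<?n. 2 ^ i / 2 + (- (2 ^ i) / 2 * (\<Prod>j = i..<?n. 1 + (- 2) * x $ h j))) +
     (\<Sum>k<?n. gray_defect h x k * (0 + - (2 ^ ?n) * x $ h k) * (1 + (- 1) * x $ h k)))"
    by (rule ext)
  also have "\<dots> \<in> poly_fun ?n"
    by (intro poly_fun_add poly_fun_sum poly_fun_const par pen)
  finally show ?thesis .
qed

lemma gray_fun_vertex:
  fixes x :: "real^'n::finite"
  assumes "x \<in> cube_vertices"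
  shows "gray_fun h x = (\<Sum>i<CARD('n). 2 ^ i * (1 - parity_sign h x i) / 2)"
proof -
  have "x $ i * (1 - x $ i) * c = 0" for i c
    using cube_verticesD[OF assms, of i] by auto
  then show ?thesis unfolding gray_fun_def by (simp only: sum.neutral_const)
qed

text \<open>The penalties vanish at the vertices. Of the remaining terms only
  \<open>B\<^sub>0\<close> involves all coordinates; it equals the alternating sign and sums to 2^n.
  Every other \<open>B\<^sub>i\<close> misses the coordinate \<open>h 0\<close>, whose factor -1 + 1
  makes the sum 0. The nonzero result excludes a degree below n.\<close>

lemma alternating_sum_gray_fun:
  fixes h :: "nat \<Rightarrow> 'n::finite"
  assumes h: "bij_betw h {..<CARD('n)} UNIV"
  shows "(\<Sum>T\<in>UNIV. (\<Prod>i\<in>UNIV. if i \<in> T then - 1 else 1) * gray_fun h (cube_vertex T)) = - (2 ^ CARD('n)) / 2"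
proof -
  let ?n = "CARD('n)" and ?s = "\<lambda>T. \<Prod>l\<in>(UNIV :: 'n set). if l \<in> T then - 1 else (1 :: real)"
  have inj: "inj_on h {i..<?n}" for i
    using h by (auto simp: bij_betw_def intro: inj_on_subset)
  have v: "cube_vertex T \<in> cube_vertices" for T :: "'n set"
    by (simp add: cube_vertices_def cube_vertex_def)
  have 0: "(\<Sum>T\<in>UNIV. ?s T) = 0"
    using sum_Pow_prod_if[of "UNIV :: 'n set" "\<lambda>_. - 1 :: real" "\<lambda>_. 1"] by simp
  have 1: "(\<Sum>T\<in>UNIV. ?s T * parity_sign h (cube_vertex T) i) = (if i = 0 then 2 ^ ?n else 0)" if "i < ?n" for i
  proof -
    let ?H = "h ` {i..<?n}"
    have "parity_sign h (cube_vertex T) i = (\<Prod>l\<in>UNIV. if l \<in> ?H then 1 - 2 * cube_vertex T $ l else 1)" for T :: "'n set"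
      by (simp add: parity_sign_def prod.If_cases prod.reindex[OF inj] o_def)
    then have "(\<Sum>T\<in>UNIV. ?s T * parity_sign h (cube_vertex T) i) =
      (\<Sum>T\<in>Pow UNIV. \<Prod>l\<in>UNIV. if l \<in> T then (if l \<in> ?H then 1 else - 1) else 1)"
      by (simp only: prod.distrib[symmetric] Pow_UNIV)
         (intro sum.cong prod.cong; simp add: cube_vertex_def)
    also have "\<dots> = (\<Prod>l\<in>UNIV. (if l \<in> ?H then 1 else - 1) + 1)"
      by (rule sum_Pow_prod_if) simp
    also have "\<dots> = (if i = 0 then 2 ^ ?n else 0)"
    proof (cases "i = 0")
      case True
      then have "?H = UNIV" using h by (simp add: bij_betw_def lessThan_atLeast0)
      then show ?thesis using True by simp
    next
      case False
      have "h 0 \<noteq> h j" if "j \<in> {i..<?n}" for j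
        using False that inj_onD[OF inj[of 0], of 0 j] by auto
      then have "h 0 \<notin> ?H" by blast
      then show ?thesis using False by (auto intro!: prod_zero bexI[of _ "h 0"])
    qed
    finally show ?thesis .
  qed
  have "(\<Sum>T\<in>UNIV. ?s T * gray_fun h (cube_vertex T)) =
    (\<Sum>i<?n. 2 ^ i / 2 * ((\<Sum>T\<in>UNIV. ?s T) - (\<Sum>T\<in>UNIV. ?s T * parity_sign h (cube_vertex T) i)))"
    unfolding gray_fun_vertex[OF v] sum_subtractf[symmetric] sum_distrib_left
    by (subst sum.swap) (simp add: algebra_simps diff_divide_distrib)
  also have "\<dots> = (\<Sum>i<?n. if i = 0 then - (2 ^ ?n) / 2 else 0)"
    by (intro sum.cong) (auto simp: 0 1)
  finally show ?thesis by simp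
qed

lemma gray_fun_mpoly:
  fixes h :: "nat \<Rightarrow> 'n::finite"
  assumes "CARD('n) > 2" and h: "bij_betw h {..<CARD('n)} UNIV"
  obtains F :: "'n real_mpoly" where "mpoly_eval F = gray_fun h" "total_degree F = CARD('n)"
proof -
  obtain F :: "'n real_mpoly" where F: "mpoly_eval F = gray_fun h" "total_degree F \<le> CARD('n)"
    using poly_fun_gray_fun[OF assms(1), of h] unfolding poly_fun_def by auto
  have "\<not> total_degree F < CARD('n)"
    using alternating_sum_mpoly_eval[of F] alternating_sum_gray_fun[OF h] F(1) by auto
  then show ?thesis using that F by simp
qed

section \<open>Slopes along the edges at a fixed vertex\<close>

context
  fixes h :: "nat \<Rightarrow> 'n::finite" and x :: "real^'n"
  assumes h: "bij_betw h {..<CARD('n)} UNIV" and x: "x \<in> cube_vertices"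
begin

lemma h_eq_iff: "i < CARD('n) \<Longrightarrow> j < CARD('n) \<Longrightarrow> h i = h j \<longleftrightarrow> i = j"
  using h by (auto simp: bij_betw_def inj_on_def)

text \<open>Along the edge, \<open>B\<^sub>i\<close> gains the factor 1 - 2t if i \<le> k and is
  constant otherwise, while \<open>D\<^sub>k\<close> is constant because it only sees coordinates
  before k. The restriction is therefore an explicit quadratic in t.\<close>

lemma gray_fun_edge:
  assumes k: "k < CARD('n)"
  shows "gray_fun h (x + t *\<^sub>R inward x (h k)) = gray_fun h x +
    t * (\<Sum>i\<le>k. 2 ^ i * parity_sign h x i) - 2 ^ CARD('n) * (t * (1 - t)) * gray_defect h x k"
proof -
  let ?n = "CARD('n)" and ?y = "x + t *\<^sub>R inward x (h k)"
  have y: "?y $ h j = (if j = k then x $ h k + t * (1 - 2 * x $ h k) else x $ h j)" if "j < ?n" for j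
    using that k by (auto simp: inward_nth h_eq_iff)
  have par: "parity_sign h ?y i = parity_sign h x i * (if i \<le> k then 1 - 2 * t else 1)" for i
  proof -
    have "parity_sign h ?y i = (\<Prod>j = i..<?n. (1 - 2 * x $ h j) * (if j = k then 1 - 2 * t else 1))"
      unfolding parity_sign_def by (intro prod.cong) (auto simp: y algebra_simps simp del: vector_add_component)
    then show ?thesis using k by (auto simp: prod.distrib parity_sign_def)
  qed
  have def: "gray_defect h ?y k = gray_defect h x k"
    unfolding gray_defect_def using k by (intro sum.cong) (auto simp: y simp del: vector_add_component)
  \<comment> \<open>The other defects may vary with t, but their factors
    \<open>?y $ h j * (1 - ?y $ h j)\<close> vanish since those coordinates stay at 0 or 1.\<close>
  have "?y $ h j * (1 - ?y $ h j) * gray_defect h ?y j =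
      (if j = k then t * (1 - t) * gray_defect h x k else 0)" if "j < ?n" for j
    unfolding y[OF that] using cube_verticesD[OF x, of "h j"] def by (auto simp: algebra_simps)
  then have "(\<Sum>j<?n. ?y $ h j * (1 - ?y $ h j) * gray_defect h ?y j) =
      (\<Sum>j<?n. (if j = k then t * (1 - t) * gray_defect h x k else 0))"
    by (intro sum.cong) auto
  then have c: "(\<Sum>j<?n. ?y $ h j * (1 - ?y $ h j) * gray_defect h ?y j) = t * (1 - t) * gray_defect h x k"
    using k by simp
  have "(\<Sum>i<?n. 2 ^ i * (1 - parity_sign h ?y i) / 2) =
    (\<Sum>i<?n. 2 ^ i * (1 - parity_sign h x i) / 2 + (if i \<le> k then t * (2 ^ i * parity_sign h x i) else 0))"
    by (intro sum.cong) (auto simp: par field_simps)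
  also have "\<dots> = gray_fun h x + (\<Sum>i\<in>{..<?n} \<inter> {..k}. t * (2 ^ i * parity_sign h x i))"
    by (simp add: sum.distrib gray_fun_vertex[OF x] sum.inter_restrict)
  also have "{..<?n} \<inter> {..k} = {..k}" using k by auto
  finally show ?thesis
    by (subst gray_fun_def) (simp add: c sum_distrib_left[symmetric] del: vector_add_component)
qed

text \<open>Both sides are the derivative of the restriction to the edge, once by the chain rule and
  once from the explicit quadratic.\<close>

lemma gradient_gray_fun_edge:
  assumes "gray_fun h differentiable (at (x + t *\<^sub>R inward x (h k)))" and k: "k < CARD('n)"
  shows "gradient (gray_fun h) (x + t *\<^sub>R inward x (h k)) \<bullet> inward x (h k) =
    (\<Sum>i\<le>k. 2 ^ i * parity_sign h x i) - 2 ^ CARD('n) * (1 - 2 * t) * gray_defect h x k"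
proof (rule DERIV_unique)
  let ?d = "inward x (h k)"
  have "(gray_fun h has_derivative (\<lambda>v. v \<bullet> gradient (gray_fun h) (x + t *\<^sub>R ?d))) (at (x + t *\<^sub>R ?d))"
    using GDERIV_gradient[OF assms(1)] by (simp add: gderiv_def)
  moreover have "((\<lambda>t. x + t *\<^sub>R ?d) has_derivative (\<lambda>s. s *\<^sub>R ?d)) (at t)"
    by (auto intro!: derivative_eq_intros)
  ultimately have "((\<lambda>t. gray_fun h (x + t *\<^sub>R ?d)) has_derivative
      (\<lambda>s. (s *\<^sub>R ?d) \<bullet> gradient (gray_fun h) (x + t *\<^sub>R ?d))) (at t)"
    by (rule has_derivative_compose[rotated])
  then show "((\<lambda>t. gray_fun h (x + t *\<^sub>R ?d)) has_real_derivative
      gradient (gray_fun h) (x + t *\<^sub>R ?d) \<bullet> ?d) (at t)"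
    by (simp add: has_field_derivative_def inner_commute mult_commute_abs)
  show "((\<lambda>t. gray_fun h (x + t *\<^sub>R ?d)) has_real_derivative
      (\<Sum>i\<le>k. 2 ^ i * parity_sign h x i) - 2 ^ CARD('n) * (1 - 2 * t) * gray_defect h x k) (at t)"
    unfolding gray_fun_edge[OF k]
    by (auto intro!: derivative_eq_intros simp: algebra_simps)
qed

lemma parity_sign_cases: "parity_sign h x i = 1 \<or> parity_sign h x i = - 1"
proof -
  have "(\<Prod>j\<in>J. 1 - 2 * x $ h j) = 1 \<or> (\<Prod>j\<in>J. 1 - 2 * x $ h j) = - 1" for J
  proof (induction J rule: infinite_finite_induct)
    case (insert j J)
    then show ?case using cube_verticesD[OF x, of "h j"] by auto
  qed auto
  then show ?thesis by (simp add: parity_sign_def)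
qed

lemma parity_sign_Suc: "i < CARD('n) \<Longrightarrow> parity_sign h x i = (1 - 2 * x $ h i) * parity_sign h x (Suc i)"
  unfolding parity_sign_def by (rule prod.atLeast_Suc_lessThan)

lemma gray_defect_eq_0_iff:
  "gray_defect h x k = 0 \<longleftrightarrow> (\<forall>j<k. x $ h j = of_bool (Suc j = k))"
proof -
  have "0 \<le> (if Suc j = k then 1 - x $ h j else x $ h j)" for j
    using cube_verticesD[OF x, of "h j"] by auto
  then show ?thesis
    unfolding gray_defect_def by (subst sum_nonneg_eq_0_iff) auto
qed

text \<open>At a vertex each summand is 0 or 1. This gap lets a fixed penalty weight outweigh every
  slope.\<close>

lemma gray_defect_ge_1:
  assumes "gray_defect h x k \<noteq> 0"
  shows "gray_defect h x k \<ge> 1"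
proof -
  have nonneg: "0 \<le> (if Suc j = k then 1 - x $ h j else x $ h j)" for j
    using cube_verticesD[OF x, of "h j"] by auto
  obtain j where j: "j < k" "x $ h j \<noteq> of_bool (Suc j = k)"
    using assms gray_defect_eq_0_iff by blast
  then have "1 = (if Suc j = k then 1 - x $ h j else x $ h j)"
    using cube_verticesD[OF x, of "h j"] by auto
  also have "\<dots> \<le> gray_defect h x k"
    unfolding gray_defect_def using j nonneg by (intro member_le_sum) auto
  finally show ?thesis .
qed

text \<open>The coordinates before k read 0...01, so all lower signs equal -
  \<open>B\<^sub>k\<close>, and 2^k - (2^k - 1) = 1 copy of \<open>B\<^sub>k\<close> is
  left.\<close>

lemma gray_slope_defect_0:
  assumes k: "k < CARD('n)" and 0: "gray_defect h x k = 0"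
  shows "(\<Sum>i\<le>k. 2 ^ i * parity_sign h x i) = parity_sign h x k"
proof -
  \<comment> \<open>Downward from k - 1: the coordinate 1 at k - 1 flips the sign once, the zeros
    below preserve it.\<close>
  have p: "parity_sign h x (k - Suc m) = - parity_sign h x k" if "m < k" for m
    using that
  proof (induction m)
    case 0
    then show ?case
      using k parity_sign_Suc[of "k - 1"] assms(2)[unfolded gray_defect_eq_0_iff, rule_format, of "k - 1"] by simp
  next
    case (Suc m)
    then have "Suc (k - Suc (Suc m)) = k - Suc m" "k - Suc m \<noteq> k" by simp_all
    then show ?case
      using Suc k parity_sign_Suc[of "k - Suc (Suc m)"]
        assms(2)[unfolded gray_defect_eq_0_iff, rule_format, of "k - Suc (Suc m)"] by simp
  qed
  have "parity_sign h x i = - parity_sign h x k" if "i < k" for i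
    using p[of "k - Suc i"] that by simp
  then have "(\<Sum>i<k. 2 ^ i * parity_sign h x i) = (\<Sum>i<k. 2 ^ i) * (- parity_sign h x k)"
    unfolding sum_distrib_right by (intro sum.cong) auto
  also have "(\<Sum>i<k. 2 ^ i) = (2 ^ k - 1 :: real)"
    by (simp add: sum_gp_strict)
  finally show ?thesis
    by (simp add: lessThan_Suc_atMost[symmetric] algebra_simps)
qed

lemma gray_slope_pos_iff:
  assumes k: "k < CARD('n)"
  shows "0 < (\<Sum>i\<le>k. 2 ^ i * parity_sign h x i) - 2 ^ CARD('n) * gray_defect h x k \<longleftrightarrow>
    gray_defect h x k = 0 \<and> parity_sign h x k = 1"
proof (cases "gray_defect h x k = 0")
  case True
  then show ?thesis
    using gray_slope_defect_0[OF k True] parity_sign_cases[of k] by auto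
next
  case False
  have "parity_sign h x i \<le> 1" for i
    using parity_sign_cases[of i] by auto
  then have "(\<Sum>i\<le>k. 2 ^ i * parity_sign h x i) \<le> (\<Sum>i\<le>k. 2 ^ i)"
    by (intro sum_mono) simp
  \<comment> \<open>This bound on the unpenalized slope, uniform in k, explains the weight
    2^n.\<close>
  also have "\<dots> \<le> (\<Sum>i<CARD('n). 2 ^ i)"
    using k by (intro sum_mono2) auto
  also have "\<dots> \<le> (2 ^ CARD('n) :: real)"
    by (simp add: sum_gp_strict)
  also have "\<dots> \<le> 2 ^ CARD('n) * gray_defect h x k"
    using gray_defect_ge_1[OF False] by simp
  finally show ?thesis using False by simp
qed

text \<open>The position is maximal iff all its bits are 1; its distance from 2^n - 1 is a sum of
  nonnegative terms, one for each bit.\<close>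

lemma gray_fun_max_iff:
  "gray_fun h x = 2 ^ CARD('n) - 1 \<longleftrightarrow> (\<forall>i<CARD('n). parity_sign h x i = - 1)"
proof -
  let ?n = "CARD('n)"
  have "gray_fun h x = (\<Sum>i<?n. 2 ^ i) - (\<Sum>i<?n. 2 ^ i * (1 + parity_sign h x i) / 2)"
    unfolding gray_fun_vertex[OF x] sum_subtractf[symmetric] by (intro sum.cong) (auto simp: field_simps)
  then have "gray_fun h x = 2 ^ ?n - 1 \<longleftrightarrow> (\<Sum>i<?n. 2 ^ i * (1 + parity_sign h x i) / 2) = 0"
    by (simp add: sum_gp_strict)
  also have "\<dots> \<longleftrightarrow> (\<forall>i<?n. 2 ^ i * (1 + parity_sign h x i) / 2 = 0)"
  proof (subst sum_nonneg_eq_0_iff)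
    show "0 \<le> 2 ^ i * (1 + parity_sign h x i) / 2" for i
      using parity_sign_cases[of i] by auto
  qed auto
  also have "\<dots> \<longleftrightarrow> (\<forall>i<?n. parity_sign h x i = - 1)"
    by (auto simp: add_eq_0_iff)
  finally show ?thesis .
qed

lemma ex_gray_slope_pos_iff:
  "(\<exists>k<CARD('n). gray_defect h x k = 0 \<and> parity_sign h x k = 1) \<longleftrightarrow> gray_fun h x \<noteq> 2 ^ CARD('n) - 1"
  (is "?L \<longleftrightarrow> _")
proof -
  have "?L \<longleftrightarrow> (\<exists>k<CARD('n). parity_sign h x k = 1)"
  proof
    assume ex: "\<exists>k<CARD('n). parity_sign h x k = 1"
    \<comment> \<open>As in a binary increment, the lowest zero bit of the position determines the
      next edge.\<close>
    define k where "k = (LEAST k. k < CARD('n) \<and> parity_sign h x k = 1)"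
    have k: "k < CARD('n)" "parity_sign h x k = 1"
      using LeastI_ex[OF ex] by (auto simp: k_def)
    have less: "parity_sign h x j = - 1" if "j < k" for j
      using not_less_Least[OF that[unfolded k_def]] that k(1) parity_sign_cases[of j] by auto
    \<comment> \<open>Consecutive signs differ iff the coordinate between them is 1. Below k this
      happens only from k - 1 to k, where -1 changes to 1.\<close>
    have "x $ h j = of_bool (Suc j = k)" if "j < k" for j
      using parity_sign_Suc[of j] less[OF that] less[of "Suc j"] k that
      by (cases "Suc j = k") auto
    then show ?L using k gray_defect_eq_0_iff by blast
  qed auto
  also have "\<dots> \<longleftrightarrow> \<not> (\<forall>k<CARD('n). parity_sign h x k = - 1)"
    using parity_sign_cases by fastforce
  finally show ?thesis using gray_fun_max_iff by simp
qed

end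

theorem theorem1:
  assumes "CARD('n::finite) > 2"
  shows "\<exists>F :: 'n real_mpoly.
           total_degree F = CARD('n) \<and>
           performs_exactly (mpoly_eval F) cube_matrix cube_rhs 0 (2 ^ CARD('n) - 1)"
proof -
  obtain h :: "nat \<Rightarrow> 'n" where h: "bij_betw h {..<CARD('n)} UNIV"
    using ex_bij_betw_nat_finite[of "UNIV :: 'n set"] by (auto simp: lessThan_atLeast0)
  obtain F :: "'n real_mpoly" where F: "mpoly_eval F = gray_fun h" "total_degree F = CARD('n)"
    using gray_fun_mpoly[OF assms h] .
  have diff: "gray_fun h differentiable (at x)" for x
    using differentiable_mpoly_eval[of F] F(1) by simp
  have slope: "gradient (gray_fun h) (x + t *\<^sub>R inward x (h k)) \<bullet> inward x (h k) =
      (\<Sum>i\<le>k. 2 ^ i * parity_sign h x i) - 2 ^ CARD('n) * (1 - 2 * t) * gray_defect h x k"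
    if "x \<in> cube_vertices" "k < CARD('n)" for x t k
    by (rule gradient_gray_fun_edge[OF h that(1) diff that(2)])
  have imp: "0 < gradient (gray_fun h) x \<bullet> inward x (h k) \<longleftrightarrow>
      gray_defect h x k = 0 \<and> parity_sign h x k = 1" if "x \<in> cube_vertices" "k < CARD('n)" for x k
    using slope[OF that, of 0] gray_slope_pos_iff[OF h that] by simp
  have surj: "\<exists>j<CARD('n). k = h j" for k
    using h unfolding bij_betw_def by (metis UNIV_I imageE lessThan_iff)
  have "performs_exactly (gray_fun h) cube_matrix cube_rhs 0 (2 ^ CARD('n) - 1)"
  proof (rule performs_exactly_cube)
    show z: "(0 :: real^'n) \<in> cube_vertices" by (simp add: cube_vertices_def)
    show "gray_fun h 0 = 0" by (simp add: gray_fun_vertex[OF z] parity_sign_def)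
  next
    fix x :: "real^'n" and k and t :: real
    assume x: "x \<in> cube_vertices" and k: "0 < gradient (gray_fun h) x \<bullet> inward x k"
    obtain j where j: "j < CARD('n)" "k = h j" using surj by blast
    note * = imp[OF x j(1), THEN iffD1, OF k[unfolded j(2)]]
    \<comment> \<open>On an ascending edge the defect is 0, so the penalty is absent and the slope
      is constantly \<open>B\<^sub>k\<close> = 1; over the whole edge the value grows by 1.\<close>
    show "0 < gradient (gray_fun h) (x + t *\<^sub>R inward x k) \<bullet> inward x k"
      using slope[OF x j(1), of t] gray_slope_defect_0[OF h x j(1)] * j(2) by simp
    show "gray_fun h (x + inward x k) = gray_fun h x + 1"
      using gray_fun_edge[OF h x j(1), of 1] gray_slope_defect_0[OF h x j(1)] * j(2) by simp
  next
    fix x :: "real^'n" assume x: "x \<in> cube_vertices"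
    have "(\<exists>k. 0 < gradient (gray_fun h) x \<bullet> inward x k) \<longleftrightarrow>
        (\<exists>j<CARD('n). gray_defect h x j = 0 \<and> parity_sign h x j = 1)"
      using imp[OF x] surj by metis
    then show "(\<exists>k. 0 < gradient (gray_fun h) x \<bullet> inward x k) \<longleftrightarrow> gray_fun h x \<noteq> real (2 ^ CARD('n) - 1)"
      using ex_gray_slope_pos_iff[OF h x] by (simp add: of_nat_diff)
  qed
  then show ?thesis using F by metis
qed

end
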